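(* Let $\mathbf X$ be a $d$-variate generalized Pareto (GP) random vector with common shape parameter $\gamma$ for all $d$ margins (i.e. $\gamma_1=\dots=\gamma_d=\gamma$) and with scale parameter $\boldsymbol\sigma>\mathbf 0$. Let $\mathbf a\in[0,\infty)^d\setminus\{\mathbf 0\}$, and if $\gamma\le0$ additionally assume that $\Pr[\sum_{j=1}^da_jX_j>0]>0$. Then the conditional distribution of the weighted sum $\sum_{j=1}^da_jX_j$ given that it is positive is (one-dimensional) generalized Pareto with shape parameter $\gamma$ and scale parameter $\sigma=\sum_{j=1}^da_j\sigma_j$.
   Context: Operations and relations on $d$-vectors are componentwise; $\wedge$ is minimum. For $\gamma=0$, $(1+\gamma x)^{1/\gamma}$ is read as $e^x$. Multivariate GP distributions. A $d$-variate GEV cdf $G$ is a max-stable cdf with non-degenerate margins (for each $t>0$ there are $\mathbf a_t\in(0,\infty)^d,\mathbf b_t\in\mathbb R^d$ with $G(\mathbf a_t\mathbf x+\mathbf b_t)^t=G(\mathbf x)$); its margins are $G_j(x)=\exp\{-(1+\gamma_j\frac{x-\mu_j}{\alpha_j})^{-1/\gamma_j}\}$ for $\alpha_j+\gamma_j(x-\mu_j)>0$, with $\gamma_j,\mu_j\in\mathbb R$, $\alpha_j>0$. Put $\sigma_j=\alpha_j-\gamma_j\mu_j$ and let $\eta_j\in\mathbb R\cup\{-\infty\}$ be the lower endpoint of $G_j$. If $0<G(\mathbf 0)<1$, the GP distribution associated to $G$, with shape parameter $\boldsymbol\gamma$ and scale parameter $\boldsymbol\sigma$, is the distribution on $[-\infty,\infty)^d$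 with cdf $H(\mathbf x)=\frac1{\log G(\mathbf 0)}\log\big(\frac{G(\mathbf x\wedge\mathbf 0)}{G(\mathbf x)}\big)$ for $\mathbf x>\boldsymbol\eta$, $H(\mathbf x)=0$ if $x_j<\eta_j$ for some $j$, and extended by right-continuity. Components may equal $-\infty$ with positive probability; terms $a_jX_j$ with $a_j=0$ are read as $0$. The one-dimensional GP distribution with shape $\gamma$ and scale $\sigma>0$ has cdf $x\mapsto1-(1+\gamma x/\sigma)^{-1/\gamma}$ for $x\ge0$ with $\sigma+\gamma x>0$ (equal to $0$ for $x<0$, and, if $\gamma<0$, equal to $1$ for $x\ge-\sigma/\gamma$). *)

theory Defs
  imports "HOL-Probability.Probability"
begin

text \<open>Vectors in \<open>d\<close> dimensions are indexed by a finite type \<open>'n\<close>, so \<open>d = CARD('n)\<close>; the order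
  on them is the library's componentwise \<open>\<le>\<close>. The library's \<open><\<close> on vectors is not componentwise
  and is therefore never used below.\<close>

definition mv_cdf :: "(real ^ 'n) measure \<Rightarrow> real ^ 'n \<Rightarrow> real"
  where "mv_cdf N x = measure N {..x}"

definition margin :: "(real ^ 'n) measure \<Rightarrow> 'n \<Rightarrow> real measure"
  where "margin N j = distr N borel (\<lambda>x. x $ j)"

text \<open>\<open>gp_tail \<gamma> z\<close> is \<open>(1 + \<gamma> z)\<close> to the power \<open>-1 / \<gamma>\<close>, for \<open>1 + \<gamma> z > 0\<close>.\<close>

definition gp_tail :: "real \<Rightarrow> real \<Rightarrow> real"
  where "gp_tail \<gamma> z = (if \<gamma> = 0 then exp (- z) else (1 + \<gamma> * z) powr (- 1 / \<gamma>))"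

definition max_stable :: "(real ^ 'n \<Rightarrow> real) \<Rightarrow> bool"
  where "max_stable G \<longleftrightarrow>
    (\<forall>t>0. \<exists>a b. (\<forall>j. a $ j > 0) \<and> (\<forall>x. G (\<chi> j. a $ j * x $ j + b $ j) powr t = G x))"

definition nondegenerate_margins :: "(real ^ 'n) measure \<Rightarrow> bool"
  where "nondegenerate_margins N \<longleftrightarrow> (\<forall>j. \<nexists>c. AE x in N. x $ j = c)"

definition mv_gev_distribution :: "(real ^ 'n) measure \<Rightarrow> bool"
  where "mv_gev_distribution N \<longleftrightarrow>
    prob_space N \<and> sets N = sets borel \<and> max_stable (mv_cdf N) \<and> nondegenerate_margins N"

text \<open>Outside \<open>\<alpha> + \<gamma> (x - \<mu>) > 0\<close> the marginal cdf is forced to be \<open>0\<close> (if \<open>\<gamma> > 0\<close>) or \<open>1\<close>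
  (if \<open>\<gamma> < 0\<close>) by monotonicity.\<close>

definition gev_margin_parameters ::
    "(real ^ 'n) measure \<Rightarrow> real ^ 'n \<Rightarrow> real ^ 'n \<Rightarrow> real ^ 'n \<Rightarrow> bool"
  where "gev_margin_parameters N \<gamma> \<mu> \<alpha> \<longleftrightarrow>
    (\<forall>j. \<alpha> $ j > 0 \<and>
      (\<forall>x. \<alpha> $ j + \<gamma> $ j * (x - \<mu> $ j) > 0 \<longrightarrow>
        cdf (margin N j) x = exp (- gp_tail (\<gamma> $ j) ((x - \<mu> $ j) / \<alpha> $ j))))"

definition lower_endpoint :: "real measure \<Rightarrow> ereal"
  where "lower_endpoint L = (INF x\<in>{x. cdf L x > 0}. ereal x)"

definition mv_gp_cdf_interior :: "(real ^ 'n \<Rightarrow> real) \<Rightarrow> real ^ 'n \<Rightarrow> real"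
  where "mv_gp_cdf_interior G x = 1 / ln (G 0) * ln (G (\<chi> j. min (x $ j) 0) / G x)"

text \<open>The last case is the extension by right-continuity: at a point \<open>x \<ge> \<eta>\<close> with some
  \<open>x $ j = \<eta> j\<close>, the limit is taken over \<open>y\<close> tending to \<open>x\<close> with all components strictly above
  those of \<open>x\<close>, hence over points \<open>y\<close> at which the first case applies.\<close>

definition mv_gp_cdf :: "(real ^ 'n) measure \<Rightarrow> real ^ 'n \<Rightarrow> real"
  where "mv_gp_cdf N x =
    (let \<eta> = (\<lambda>j. lower_endpoint (margin N j)) in
      if \<forall>j. \<eta> j < ereal (x $ j) then mv_gp_cdf_interior (mv_cdf N) x
      else if \<exists>j. ereal (x $ j) < \<eta> j then 0
      else Lim (at x within {y. \<forall>j. x $ j < y $ j}) (mv_gp_cdf_interior (mv_cdf N)))"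

text \<open>The generalized Pareto law lives on \<open>[-\<infinity>, \<infinity>)\<close> to the power \<open>d\<close>; its cdf at real arguments
  determines it.\<close>

definition mv_gp_distribution ::
    "(ereal ^ 'n) measure \<Rightarrow> real ^ 'n \<Rightarrow> real ^ 'n \<Rightarrow> bool"
  where "mv_gp_distribution D \<gamma> \<sigma> \<longleftrightarrow>
    (\<exists>N \<mu> \<alpha>. mv_gev_distribution N \<and> gev_margin_parameters N \<gamma> \<mu> \<alpha> \<and>
      (\<forall>j. \<sigma> $ j = \<alpha> $ j - \<gamma> $ j * \<mu> $ j) \<and>
      0 < mv_cdf N 0 \<and> mv_cdf N 0 < 1 \<and>
      prob_space D \<and> sets D = sets borel \<and> (AE y in D. \<forall>j. y $ j < \<infinity>) \<and>
      (\<forall>x. measure D {..(\<chi> j. ereal (x $ j))} = mv_gp_cdf N x))"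

text \<open>For \<open>\<sigma> > 0\<close> and \<open>x \<ge> 0\<close> the last case means \<open>\<gamma> < 0\<close> and \<open>x \<ge> - \<sigma> / \<gamma>\<close>.\<close>

definition gp_cdf :: "real \<Rightarrow> real \<Rightarrow> real \<Rightarrow> real"
  where "gp_cdf \<gamma> \<sigma> x =
    (if x < 0 then 0 else if \<sigma> + \<gamma> * x > 0 then 1 - gp_tail \<gamma> (x / \<sigma>) else 1)"

text \<open>The one-dimensional law is regarded as a law on \<open>ereal\<close>, since weighted sums of components
  can be \<open>-\<infinity>\<close>; the condition on the cdf leaves no mass at \<open>\<plusminus>\<infinity>\<close>.\<close>

definition gp_distribution :: "ereal measure \<Rightarrow> real \<Rightarrow> real \<Rightarrow> bool"
  where "gp_distribution D \<gamma> \<sigma> \<longleftrightarrow>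
    \<sigma> > 0 \<and> prob_space D \<and> sets D = sets borel \<and>
    (\<forall>x. measure D {..ereal x} = gp_cdf \<gamma> \<sigma> x)"

text \<open>In \<open>ereal\<close>, \<open>0 * (-\<infinity>) = 0\<close>, so terms with \<open>a $ j = 0\<close> vanish.\<close>

definition weighted_sum :: "real ^ 'n \<Rightarrow> ereal ^ 'n \<Rightarrow> ereal"
  where "weighted_sum a x = (\<Sum>j\<in>UNIV. ereal (a $ j) * x $ j)"

end

theory Submission
  imports Defs
begin

text \<open>
  Write \<open>c = t powr \<gamma>\<close> and let \<open>T\<^sub>t\<close> be the componentwise affine map
  \<open>x \<mapsto> c x + \<sigma> (c - 1) / \<gamma>\<close> (\<open>x \<mapsto> x + \<sigma> ln t\<close> if \<open>\<gamma> = 0\<close>), so that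
  \<open>\<sigma> + \<gamma> T\<^sub>t x = c (\<sigma> + \<gamma> x)\<close>. Comparing margins in the max-stability relation
  identifies its normalization: \<open>G (T\<^sub>t x) powr t = G x\<close> for every \<open>t > 0\<close> (lemma \<open>G_T\<close>).
  Consequently \<open>ln G\<close> is divided by \<open>t\<close> under \<open>T\<^sub>t\<close>, and the formula for the generalized Pareto
  cdf turns this, for \<open>t \<ge> 1\<close>, into threshold stability (lemma \<open>threshold_stability\<close>):
  on the event that \<open>X \<le> T\<^sub>t 0\<close> fails, the inverse image of \<open>X\<close> under \<open>T\<^sub>t\<close> has
  \<open>1 / t\<close> times the law of \<open>X\<close>.
  It suffices to compare cdfs at real arguments, because no component equals \<open>\<infinity>\<close>
  (lemma \<open>ereal_vector_measure_eqI\<close>).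

  A weighted sum with nonnegative weights commutes with \<open>T\<^sub>t\<close> once \<open>\<sigma>\<close> is replaced by
  \<open>s = (\<Sum>j. a\<^sub>j \<sigma>\<^sub>j)\<close>; this uses that the shape is common to all components. Moreover the sum
  can exceed its value at \<open>T\<^sub>t 0\<close> only if \<open>X \<le> T\<^sub>t 0\<close> fails. Hence, for the weighted sum \<open>S\<close>,
  \<open>P (S > s (c - 1) / \<gamma>) = P (S > 0) / t\<close> for all \<open>t \<ge> 1\<close>
  (lemma \<open>weighted_sum_threshold_stability\<close>). Solving \<open>s (c - 1) / \<gamma> = x\<close> for \<open>t\<close> gives
  \<open>1 / t = (1 + \<gamma> x / s) powr (- 1 / \<gamma>)\<close>, the generalized Pareto tail.

  If \<open>\<gamma> > 0\<close>, then \<open>P (S > 0) > 0\<close> holds automatically: all components are bounded below by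
  \<open>- \<sigma>\<^sub>j / \<gamma>\<close>, while each of them exceeds every level with positive probability
  (lemma \<open>weighted_sum_pos\<close>).
\<close>

section \<open>Laws of vectors in the half-open extended reals\<close>

text \<open>The exponential function, an order isomorphism from \<open>[-\<infinity>, \<infinity>)\<close> onto \<open>[0, \<infinity>)\<close>, and its
  inverse. Composing with it reduces laws on \<open>[-\<infinity>, \<infinity>)\<close> to laws on the reals. The values at \<open>\<infinity>\<close>
  and at negative arguments are irrelevant.\<close>

definition ereal_to_nonneg :: "ereal \<Rightarrow> real"
  where "ereal_to_nonneg y = (if \<bar>y\<bar> = \<infinity> then 0 else exp (real_of_ereal y))"

definition nonneg_to_ereal :: "real \<Rightarrow> ereal"
  where "nonneg_to_ereal r = (if r \<le> 0 then - \<infinity> else ereal (ln r))"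

lemma measurable_ereal_to_nonneg [measurable]: "ereal_to_nonneg \<in> borel_measurable borel"
  unfolding ereal_to_nonneg_def by measurable

lemma measurable_nonneg_to_ereal [measurable]: "nonneg_to_ereal \<in> borel_measurable borel"
  unfolding nonneg_to_ereal_def by measurable

lemma nonneg_to_ereal_inverse: "y < \<infinity> \<Longrightarrow> nonneg_to_ereal (ereal_to_nonneg y) = y"
  by (cases y) (auto simp: nonneg_to_ereal_def ereal_to_nonneg_def)

lemma ereal_to_nonneg_le_iff:
  assumes "y < \<infinity>" "r > 0"
  shows "ereal_to_nonneg y \<le> r \<longleftrightarrow> y \<le> ereal (ln r)"
  using assms by (cases y) (auto simp: ereal_to_nonneg_def ln_ge_iff)

lemma ereal_to_nonneg_nonneg: "ereal_to_nonneg y \<ge> 0"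
  by (auto simp: ereal_to_nonneg_def)

lemma finite_measure_eqI_atMost:
  fixes P Q :: "'b::ordered_euclidean_space measure"
  assumes "finite_measure P" "finite_measure Q" "sets P = sets borel" "sets Q = sets borel"
    and eq: "\<And>z. measure P {..z} = measure Q {..z}"
  shows "P = Q"
proof (rule measure_eqI_generator_eq[where E="range (\<lambda>a. {..a})" and \<Omega>=UNIV
      and A="\<lambda>n. {..\<Sum>b\<in>Basis. real n *\<^sub>R b}"])
  show "Int_stable (range (\<lambda>a::'b. {..a}))"
  proof (rule Int_stableI_image)
    show "\<exists>c\<in>UNIV. {..a} \<inter> {..b} = {..c}" for a b :: 'b
      by (rule bexI[of _ "inf a b"]) auto
  qed
  show "sets P = sigma_sets UNIV (range (\<lambda>a. {..a}))" "sets Q = sigma_sets UNIV (range (\<lambda>a. {..a}))"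
    using assms by (simp_all add: borel_eq_atMost)
  show "emeasure P Y = emeasure Q Y" if "Y \<in> range (\<lambda>a. {..a})" for Y
    using that eq assms(1,2) by (auto simp: finite_measure.emeasure_eq_measure)
  show "emeasure P {..\<Sum>b\<in>Basis. real n *\<^sub>R b} \<noteq> \<infinity>" for n
    using assms(1) by (simp add: finite_measure.emeasure_eq_measure)
  show "(\<Union>n. {..\<Sum>b\<in>Basis. real n *\<^sub>R b}) = (UNIV :: 'b set)"
  proof safe
    fix x :: 'b
    obtain n where n: "norm x \<le> real n" using real_arch_simple by blast
    have "x \<le> (\<Sum>b\<in>Basis. real n *\<^sub>R b)"
      unfolding eucl_le[of x]
    proof
      fix b :: 'b assume "b \<in> Basis"
      then show "x \<bullet> b \<le> (\<Sum>b\<in>Basis. real n *\<^sub>R b) \<bullet> b"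
        using Basis_le_norm[of b x] n by (simp add: inner_sum_left inner_Basis if_distrib cong: if_cong)
    qed
    then show "x \<in> (\<Union>n. {..\<Sum>b\<in>Basis. real n *\<^sub>R b})" by blast
  qed auto
qed auto

lemma (in finite_measure) atMost_vec_right_continuous:
  fixes Z :: "'a \<Rightarrow> real ^ 'n"
  assumes [measurable]: "Z \<in> borel_measurable M"
  shows "(\<lambda>k. measure M {\<omega>\<in>space M. \<forall>j. Z \<omega> $ j \<le> z $ j + 1 / Suc k})
    \<longlonglongrightarrow> measure M {\<omega>\<in>space M. \<forall>j. Z \<omega> $ j \<le> z $ j}"
proof -
  have [measurable]: "(\<lambda>\<omega>. Z \<omega> $ j) \<in> borel_measurable M" for j
    by (intro borel_measurable_continuous_on[OF _ assms] continuous_intros)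
  let ?A = "\<lambda>k. {\<omega>\<in>space M. \<forall>j. Z \<omega> $ j \<le> z $ j + 1 / Suc k}"
  have "(\<lambda>k. measure M (?A k)) \<longlonglongrightarrow> measure M (\<Inter>k. ?A k)"
  proof (rule finite_Lim_measure_decseq)
    show "range ?A \<subseteq> sets M" by auto
    show "decseq ?A"
    proof (rule decseq_SucI, safe)
      fix k \<omega> j assume "\<forall>j. Z \<omega> $ j \<le> z $ j + 1 / Suc (Suc k)"
      moreover have "1 / real (Suc (Suc k)) \<le> 1 / Suc k" by (simp add: field_simps)
      ultimately show "Z \<omega> $ j \<le> z $ j + 1 / Suc k" by (meson add_left_mono order_trans)
    qed
  qed
  moreover have "(\<Inter>k. ?A k) = {\<omega>\<in>space M. \<forall>j. Z \<omega> $ j \<le> z $ j}"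
  proof safe
    fix \<omega> j assume *: "\<omega> \<in> (\<Inter>k. ?A k)"
    show "Z \<omega> $ j \<le> z $ j"
    proof (rule LIMSEQ_le_const)
      show "(\<lambda>k. z $ j + 1 / Suc k) \<longlonglongrightarrow> z $ j"
        using tendsto_add[OF tendsto_const LIMSEQ_inverse_real_of_nat, of "z $ j"]
        by (simp add: inverse_eq_divide)
      show "\<exists>n0. \<forall>k\<ge>n0. Z \<omega> $ j \<le> z $ j + 1 / Suc k" using * by auto
    qed
  next
    fix \<omega> k j assume "\<forall>j. Z \<omega> $ j \<le> z $ j"
    then show "Z \<omega> $ j \<le> z $ j + 1 / Suc k" by (simp add: add_increasing2)
  qed auto
  ultimately show ?thesis by simp
qed

text \<open>A finite measure on \<open>[-\<infinity>, \<infinity>)\<close> to the power \<open>d\<close> is determined by its cdf at real arguments. If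
  both cdfs vanish as soon as one argument is below \<open>\<eta>\<close>, it is enough to compare them at arguments with
  every component strictly above \<open>\<eta>\<close>, by right-continuity.\<close>

lemma ereal_vector_measure_eqI:
  fixes P Q :: "('n::finite \<Rightarrow> ereal) measure" and \<eta> :: "'n \<Rightarrow> ereal"
  assumes fin: "finite_measure P" "finite_measure Q"
    and sets: "sets P = sets (Pi\<^sub>M UNIV (\<lambda>_. borel))" "sets Q = sets (Pi\<^sub>M UNIV (\<lambda>_. borel))"
    and AE: "AE f in P. \<forall>j. f j < \<infinity>" "AE f in Q. \<forall>j. f j < \<infinity>"
    and \<eta>: "\<And>j. \<eta> j < \<infinity>"
    and above: "\<And>x. (\<And>j. \<eta> j < ereal (x j)) \<Longrightarrow>
      measure P {f. \<forall>j. f j \<le> ereal (x j)} = measure Q {f. \<forall>j. f j \<le> ereal (x j)}"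
    and below: "\<And>x j. ereal (x j) < \<eta> j \<Longrightarrow> measure P {f. \<forall>j. f j \<le> ereal (x j)} = 0"
      "\<And>x j. ereal (x j) < \<eta> j \<Longrightarrow> measure Q {f. \<forall>j. f j \<le> ereal (x j)} = 0"
  shows "P = Q"
proof -
  define e :: "('n \<Rightarrow> ereal) \<Rightarrow> real ^ 'n" where "e f = (\<chi> j. ereal_to_nonneg (f j))" for f
  define l :: "real ^ 'n \<Rightarrow> ('n \<Rightarrow> ereal)" where "l z = (\<lambda>j. nonneg_to_ereal (z $ j))" for z
  let ?S = "Pi\<^sub>M UNIV (\<lambda>_. borel) :: ('n \<Rightarrow> ereal) measure"
  have comp: "(\<lambda>f. f j) \<in> borel_measurable ?S" for j by measurable
  have e_meas: "e \<in> borel_measurable ?S"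
  proof (subst borel_measurable_euclidean_space, rule ballI)
    fix b :: "real ^ 'n" assume "b \<in> Basis"
    then obtain j where "b = axis j 1" by (auto simp: Basis_vec_def)
    then show "(\<lambda>f. e f \<bullet> b) \<in> borel_measurable ?S"
      by (simp add: e_def inner_axis) measurable
  qed
  have l_meas: "l \<in> measurable borel ?S"
    unfolding l_def by (rule measurable_PiM_single')
      (auto intro!: measurable_compose[OF _ measurable_nonneg_to_ereal])
  have pos: "measure R {f\<in>space R. \<forall>j. e f $ j \<le> z $ j} = measure R {f. \<forall>j. f j \<le> ereal (ln (z $ j))}"
    if "finite_measure R" "sets R = sets ?S" "AE f in R. \<forall>j. f j < \<infinity>" "\<And>j. z $ j > 0" for R z
  proof -
    interpret finite_measure R by fact
    have [simp]: "space R = UNIV" using sets_eq_imp_space_eq[OF that(2)] by (simp add: space_PiM)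
    have [measurable_cong]: "sets R = sets ?S" by fact
    have [measurable]: "e \<in> borel_measurable ?S" by (fact e_meas)
    have "{f\<in>space R. \<forall>j. e f $ j \<le> z $ j} \<in> sets R"
      unfolding e_def vec_lambda_beta by measurable
    moreover have "{f\<in>space R. \<forall>j. f j \<le> ereal (ln (z $ j))} \<in> sets R" by measurable
    moreover have "AE f in R. f \<in> {f\<in>space R. \<forall>j. e f $ j \<le> z $ j}
        \<longleftrightarrow> f \<in> {f\<in>space R. \<forall>j. f j \<le> ereal (ln (z $ j))}"
      using that(3) by eventually_elim (simp add: e_def ereal_to_nonneg_le_iff that(4))
    ultimately show ?thesis
      using finite_measure_eq_AE by fastforce
  qed
  have mono: "measure R {f\<in>space R. \<forall>j. e f $ j \<le> z $ j} \<le> measure R {f\<in>space R. \<forall>j. e f $ j \<le> z' $ j}"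
    if "finite_measure R" "sets R = sets ?S" "\<And>j. z $ j \<le> z' $ j" for R z z'
  proof (rule finite_measure.finite_measure_mono[OF that(1)])
    show "{f\<in>space R. \<forall>j. e f $ j \<le> z $ j} \<subseteq> {f\<in>space R. \<forall>j. e f $ j \<le> z' $ j}"
      using that(3) order_trans by blast
    have [measurable_cong]: "sets R = sets ?S" by fact
    show "{f\<in>space R. \<forall>j. e f $ j \<le> z' $ j} \<in> sets R"
      unfolding e_def vec_lambda_beta by measurable
  qed
  have zero: "measure R {f\<in>space R. \<forall>j. e f $ j \<le> z $ j} = 0"
    if R: "finite_measure R" "sets R = sets ?S" "AE f in R. \<forall>j. f j < \<infinity>"
      and 0: "\<And>x j. ereal (x j) < \<eta> j \<Longrightarrow> measure R {f. \<forall>j. f j \<le> ereal (x j)} = 0"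
      and z: "z $ j < ereal_to_nonneg (\<eta> j)" for R z j
  proof (cases "z $ j < 0")
    case True
    then have "{f\<in>space R. \<forall>j. e f $ j \<le> z $ j} = {}"
      using ereal_to_nonneg_nonneg by (force simp: e_def not_le intro: order.strict_trans2)
    then show ?thesis by (simp only: measure_empty)
  next
    case False
    obtain r where r: "z $ j < r" "r < ereal_to_nonneg (\<eta> j)" using dense[OF z] by auto
    \<comment> \<open>A larger argument with positive components whose \<open>j\<close>-th one is still below the exponential of \<open>\<eta> j\<close>.\<close>
    define z' :: "real ^ 'n" where "z' = (\<chi> i. if i = j then r else max 1 (z $ i))"
    have "ereal (ln (z' $ j)) < \<eta> j"
      using r False ereal_to_nonneg_le_iff[of "\<eta> j" r] \<eta>[of j] by (simp add: z'_def)
    moreover have "0 < z' $ i" for i using r False by (auto simp: z'_def)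
    ultimately have "measure R {f\<in>space R. \<forall>j. e f $ j \<le> z' $ j} = 0"
      using 0[of "\<lambda>i. ln (z' $ i)" j] pos[OF R, of z'] by presburger
    moreover have "z $ i \<le> z' $ i" for i using r by (auto simp: z'_def)
    ultimately show ?thesis
      using mono[OF R(1,2), of z z'] by (simp add: measure_le_0_iff)
  qed
  have lim: "(\<lambda>k. measure R {f\<in>space R. \<forall>j. e f $ j \<le> z $ j + 1 / Suc k})
      \<longlonglongrightarrow> measure R {f\<in>space R. \<forall>j. e f $ j \<le> z $ j}"
    if R: "finite_measure R" "sets R = sets ?S" for R z
  proof -
    have "e \<in> borel_measurable R" using e_meas R(2) by (simp cong: measurable_cong_sets)
    then show ?thesis by (rule finite_measure.atMost_vec_right_continuous[OF R(1)])
  qed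
  have cdf_eq: "measure P {f\<in>space P. \<forall>j. e f $ j \<le> z $ j} = measure Q {f\<in>space Q. \<forall>j. e f $ j \<le> z $ j}"
    for z
  proof (cases "\<exists>j. z $ j < ereal_to_nonneg (\<eta> j)")
    case True
    then obtain j where "z $ j < ereal_to_nonneg (\<eta> j)" by blast
    then show ?thesis
      using zero[OF fin(1) sets(1) AE(1) below(1)] zero[OF fin(2) sets(2) AE(2) below(2)] by simp
  next
    case False
    \<comment> \<open>Adding \<open>1 / Suc k\<close> moves all components strictly above the exponential of \<open>\<eta>\<close>, and above \<open>0\<close>.\<close>
    have "measure P {f\<in>space P. \<forall>j. e f $ j \<le> z $ j + 1 / Suc k}
      = measure Q {f\<in>space Q. \<forall>j. e f $ j \<le> z $ j + 1 / Suc k}" for k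
    proof -
      define z' where "z' = (\<chi> j. z $ j + 1 / Suc k)"
      have gt: "ereal_to_nonneg (\<eta> j) < z' $ j" for j
        using False by (auto simp: z'_def not_less intro: add_strict_increasing2 le_less_trans)
      have gt0: "0 < z' $ j" for j
        using gt[of j] ereal_to_nonneg_nonneg[of "\<eta> j"] by linarith
      have "\<eta> j < ereal (ln (z' $ j))" for j
      proof (cases "\<eta> j")
        case (real r)
        then have "exp r < z' $ j" using gt[of j] by (simp add: ereal_to_nonneg_def)
        then have "r < ln (z' $ j)" using gt0[of j] by (metis exp_less_cancel_iff exp_ln)
        then show ?thesis using real by simp
      qed (use \<eta>[of j] in auto)
      then have "measure P {f\<in>space P. \<forall>j. e f $ j \<le> z' $ j} = measure Q {f\<in>space Q. \<forall>j. e f $ j \<le> z' $ j}"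
        using pos[OF fin(1) sets(1) AE(1) gt0] pos[OF fin(2) sets(2) AE(2) gt0] above by presburger
      then show ?thesis by (simp add: z'_def)
    qed
    then show ?thesis
      using lim[OF fin(1) sets(1), of z] lim[OF fin(2) sets(2), of z] LIMSEQ_unique by auto
  qed
  have *: "finite_measure (distr R borel e)" "sets (distr R borel e) = sets borel"
    "measure (distr R borel e) {..z} = measure R {f\<in>space R. \<forall>j. e f $ j \<le> z $ j}"
    "R = distr (distr R borel e) ?S l"
    if R: "finite_measure R" "sets R = sets ?S" "AE f in R. \<forall>j. f j < \<infinity>" for R z
  proof -
    have eR: "e \<in> borel_measurable R" using e_meas R(2) by (simp cong: measurable_cong_sets)
    show "finite_measure (distr R borel e)"
      using R(1) eR by (rule finite_measure.finite_measure_distr)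
    show "sets (distr R borel e) = sets borel" by simp
    have "{..z} \<in> sets borel" by simp
    then show "measure (distr R borel e) {..z} = measure R {f\<in>space R. \<forall>j. e f $ j \<le> z $ j}"
      using eR by (simp add: measure_distr vimage_def Int_def less_eq_vec_def conj_commute)
    have "R = distr R R (\<lambda>f. f)" by (simp add: distr_id)
    also have "\<dots> = distr R ?S (l \<circ> e)"
    proof (rule distr_cong_AE)
      show "AE f in R. f = (l \<circ> e) f"
        using R(3) by eventually_elim (auto simp: l_def e_def nonneg_to_ereal_inverse)
    qed (use R(2) eR l_meas in auto)
    also have "\<dots> = distr (distr R borel e) ?S l"
      using l_meas eR by (simp add: distr_distr)
    finally show "R = distr (distr R borel e) ?S l" .
  qed
  have "distr P borel e = distr Q borel e"
    by (rule finite_measure_eqI_atMost)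
      (use *[OF fin(1) sets(1) AE(1)] *[OF fin(2) sets(2) AE(2)] cdf_eq in auto)
  then show "P = Q"
    using *(4)[OF fin(1) sets(1) AE(1)] *(4)[OF fin(2) sets(2) AE(2)] by simp
qed

section \<open>The affine normalization of generalized Pareto tails\<close>

text \<open>The function \<open>(t powr \<gamma> - 1) / \<gamma>\<close>, continuously extended to \<open>\<gamma> = 0\<close>. On \<open>1 + \<gamma> z > 0\<close> it inverts
  \<open>z \<mapsto> 1 / gp_tail \<gamma> z\<close>.\<close>

definition gp_shift :: "real \<Rightarrow> real \<Rightarrow> real"
  where "gp_shift \<gamma> t = (if \<gamma> = 0 then ln t else (t powr \<gamma> - 1) / \<gamma>)"

lemma gp_shift_eq: "t > 0 \<Longrightarrow> \<gamma> * gp_shift \<gamma> t = t powr \<gamma> - 1"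
  by (simp add: gp_shift_def)

lemma gp_shift_nonneg:
  assumes "t \<ge> 1"
  shows "gp_shift \<gamma> t \<ge> 0"
proof (cases "\<gamma> > 0")
  case True
  then show ?thesis using assms by (simp add: gp_shift_def ge_one_powr_ge_zero)
next
  case False
  then have "t powr \<gamma> \<le> 1" using assms powr_mono[of \<gamma> 0 t] by simp
  then show ?thesis using assms False by (simp add: gp_shift_def divide_nonpos_neg)
qed

lemma gp_tail_pos: "1 + \<gamma> * z > 0 \<Longrightarrow> gp_tail \<gamma> z > 0"
  by (simp add: gp_tail_def)

lemma gp_tail_inj:
  assumes "1 + \<gamma> * y > 0" "1 + \<gamma> * z > 0" "gp_tail \<gamma> y = gp_tail \<gamma> z"
  shows "y = z"
proof (cases "\<gamma> = 0")
  case False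
  then have "(-1/\<gamma>) * ln (1 + \<gamma> * y) = (-1/\<gamma>) * ln (1 + \<gamma> * z)"
    using assms by (metis gp_tail_def ln_powr)
  then have "ln (1 + \<gamma> * y) = ln (1 + \<gamma> * z)" using False by simp
  then show ?thesis using assms False by simp
qed (use assms in \<open>simp add: gp_tail_def\<close>)

lemma gp_shift_inverse_gp_tail:
  assumes "1 + \<gamma> * z > 0"
  shows "gp_shift \<gamma> (1 / gp_tail \<gamma> z) = z"
  using assms by (auto simp: gp_tail_def gp_shift_def powr_divide powr_powr powr_minus divide_inverse exp_minus)

lemma gp_tail_le_one:
  assumes "1 + \<gamma> * z > 0" "z \<ge> 0"
  shows "gp_tail \<gamma> z \<le> 1"
proof (cases "\<gamma> > 0")
  case True
  then show ?thesis using assms by (simp add: gp_tail_def powr_le1 powr_minus_divide ge_one_powr_ge_zero)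
next
  case False
  then show ?thesis using assms
    by (auto simp: gp_tail_def mult_nonpos_nonneg intro!: powr_le1 divide_nonneg_nonpos)
qed

lemma gp_tail_affine:
  assumes "t > 0" "\<alpha> > 0" "\<alpha> + \<gamma> * (x - \<mu>) > 0"
  shows "gp_tail \<gamma> ((t powr \<gamma> * x + (\<alpha> - \<gamma> * \<mu>) * gp_shift \<gamma> t - \<mu>) / \<alpha>) = gp_tail \<gamma> ((x - \<mu>) / \<alpha>) / t"
proof (cases "\<gamma> = 0")
  case True
  have "- ((x + \<alpha> * ln t - \<mu>) / \<alpha>) = - ((x - \<mu>) / \<alpha>) - ln t"
    using assms by (simp add: field_simps)
  then show ?thesis using True assms by (simp add: gp_tail_def gp_shift_def exp_diff)
next
  case False
  have "1 + \<gamma> * ((t powr \<gamma> * x + (\<alpha> - \<gamma> * \<mu>) * gp_shift \<gamma> t - \<mu>) / \<alpha>)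
      = t powr \<gamma> * (1 + \<gamma> * ((x - \<mu>) / \<alpha>))"
    using assms False by (simp add: field_simps gp_shift_def)
  then show ?thesis
    using assms False by (simp add: gp_tail_def powr_mult powr_powr powr_minus_divide)
qed

section \<open>Generalized extreme value distributions with common shape\<close>

text \<open>A multivariate generalized extreme value distribution \<open>N\<close> whose margins share the shape \<open>\<gamma>\<close>,
  with positive scale \<open>\<sigma>\<close> of the associated generalized Pareto law.\<close>

locale gev_common_shape =
  fixes N :: "(real ^ 'n) measure" and \<gamma> :: real and \<mu> \<alpha> \<sigma> :: "real ^ 'n"
  assumes gev: "mv_gev_distribution N"
    and parameters: "gev_margin_parameters N (\<chi> j. \<gamma>) \<mu> \<alpha>"
    and \<sigma>_eq: "\<And>j. \<sigma> $ j = \<alpha> $ j - \<gamma> * \<mu> $ j"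
    and \<sigma>_pos: "\<And>j. \<sigma> $ j > 0"
begin

abbreviation G :: "real ^ 'n \<Rightarrow> real"
  where "G \<equiv> mv_cdf N"

abbreviation F :: "'n \<Rightarrow> real \<Rightarrow> real"
  where "F j \<equiv> cdf (margin N j)"

text \<open>The affine normalization of max-stability in component \<open>j\<close>. The marginal cdf takes a value strictly
  between \<open>0\<close> and \<open>1\<close> exactly where \<open>\<sigma> $ j + \<gamma> * x > 0\<close>, and \<open>T t j\<close> preserves this set.\<close>

definition T :: "real \<Rightarrow> 'n \<Rightarrow> real \<Rightarrow> real"
  where "T t j x = t powr \<gamma> * x + \<sigma> $ j * gp_shift \<gamma> t"

sublocale N: prob_space N
  using gev by (simp add: mv_gev_distribution_def)

lemma sets_N [measurable_cong, simp]: "sets N = sets borel"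
  using gev by (simp add: mv_gev_distribution_def)

lemma space_N [simp]: "space N = UNIV"
  using sets_eq_imp_space_eq[OF sets_N] by simp

lemma \<alpha>_pos: "\<alpha> $ j > 0"
  using parameters by (simp add: gev_margin_parameters_def)

lemma F_measure: "F j x = measure N {y. y $ j \<le> x}"
  by (simp add: cdf_def margin_def measure_distr vimage_def)

lemma F_mono: "x \<le> y \<Longrightarrow> F j x \<le> F j y"
  unfolding F_measure by (rule N.finite_measure_mono) auto

lemma F_eq: "\<sigma> $ j + \<gamma> * x > 0 \<Longrightarrow> F j x = exp (- gp_tail \<gamma> ((x - \<mu> $ j) / \<alpha> $ j))"
  using parameters by (simp add: gev_margin_parameters_def \<sigma>_eq algebra_simps)

lemma tail_arg_pos:
  assumes "\<sigma> $ j + \<gamma> * x > 0" shows "1 + \<gamma> * ((x - \<mu> $ j) / \<alpha> $ j) > 0"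
proof -
  have "1 + \<gamma> * ((x - \<mu> $ j) / \<alpha> $ j) = (\<sigma> $ j + \<gamma> * x) / \<alpha> $ j"
    using \<alpha>_pos[of j] by (simp add: \<sigma>_eq field_simps)
  then show ?thesis using assms \<alpha>_pos[of j] by simp
qed

lemma F_interior:
  assumes "\<sigma> $ j + \<gamma> * x > 0" shows "0 < F j x" "F j x < 1"
  using assms gp_tail_pos[OF tail_arg_pos[OF assms]] by (auto simp: F_eq)

lemma F_inj:
  assumes "\<sigma> $ j + \<gamma> * x > 0" "\<sigma> $ j + \<gamma> * y > 0" "F j x = F j y"
  shows "x = y"
  using gp_tail_inj[OF tail_arg_pos[OF assms(1)] tail_arg_pos[OF assms(2)]] assms \<alpha>_pos[of j]
  by (simp add: F_eq)

lemma T_support: "t > 0 \<Longrightarrow> \<sigma> $ j + \<gamma> * T t j x = t powr \<gamma> * (\<sigma> $ j + \<gamma> * x)"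
  using gp_shift_eq[of t \<gamma>] unfolding T_def by algebra

lemma T_mono: "x \<le> y \<Longrightarrow> T t j x \<le> T t j y"
  by (simp add: T_def mult_left_mono)

lemma T_support_pos_iff: "t > 0 \<Longrightarrow> \<sigma> $ j + \<gamma> * T t j x > 0 \<longleftrightarrow> \<sigma> $ j + \<gamma> * x > 0"
  by (simp add: T_support zero_less_mult_iff)

lemma T_support_neg_iff: "t > 0 \<Longrightarrow> \<sigma> $ j + \<gamma> * T t j x < 0 \<longleftrightarrow> \<sigma> $ j + \<gamma> * x < 0"
  by (simp add: T_support mult_less_0_iff)

lemma F_T:
  assumes "t > 0" "\<sigma> $ j + \<gamma> * x > 0"
  shows "F j (T t j x) = exp (- gp_tail \<gamma> ((x - \<mu> $ j) / \<alpha> $ j) / t)"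
  using assms gp_tail_affine[of t "\<alpha> $ j" \<gamma> x "\<mu> $ j"] \<alpha>_pos[of j]
  by (simp add: F_eq T_support_pos_iff) (simp add: T_def \<sigma>_eq algebra_simps)

lemma F_T_powr:
  assumes "t > 0" "\<sigma> $ j + \<gamma> * x > 0"
  shows "F j (T t j x) powr t = F j x"
  using assms by (simp add: F_T F_eq exp_powr_real)

lemma F_below:
  assumes "\<gamma> > 0" "\<sigma> $ j + \<gamma> * x \<le> 0"
  shows "F j x = 0"
proof -
  define u where "u = gp_tail \<gamma> ((0 - \<mu> $ j) / \<alpha> $ j)"
  have "u > 0" using gp_tail_pos[OF tail_arg_pos[of j 0]] \<sigma>_pos[of j] by (simp add: u_def)
  have "F j x \<le> exp (- u * Suc k)" for k
  proof -
    \<comment> \<open>The points \<open>T (1 / Suc k) j 0\<close> decrease to the lower endpoint and stay above \<open>x\<close>.\<close>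
    have "\<sigma> $ j + \<gamma> * T (1 / Suc k) j 0 > 0" using \<sigma>_pos[of j] T_support_pos_iff by simp
    then have "\<gamma> * x \<le> \<gamma> * T (1 / Suc k) j 0" using assms by linarith
    then have "x \<le> T (1 / Suc k) j 0" using assms(1) mult_le_cancel_left_pos by blast
    then show ?thesis using F_mono[of x "T (1 / Suc k) j 0" j] F_T[of "1 / Suc k" j 0] \<sigma>_pos[of j]
      by (simp add: u_def)
  qed
  moreover have "(\<lambda>k. exp (- u * Suc k)) \<longlonglongrightarrow> 0"
    using \<open>u > 0\<close> by real_asymp
  ultimately have "F j x \<le> 0" by (meson LIMSEQ_le_const)
  then show ?thesis by (simp add: F_measure measure_le_0_iff)
qed

lemma F_above:
  assumes "\<gamma> < 0" "\<sigma> $ j + \<gamma> * x \<le> 0"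
  shows "F j x = 1"
proof -
  define u where "u = gp_tail \<gamma> ((0 - \<mu> $ j) / \<alpha> $ j)"
  have "F j x \<ge> exp (- u / Suc k)" for k
  proof -
    \<comment> \<open>The points \<open>T (Suc k) j 0\<close> increase to the upper endpoint and stay below \<open>x\<close>.\<close>
    have "\<sigma> $ j + \<gamma> * T (Suc k) j 0 > 0" using \<sigma>_pos[of j] T_support_pos_iff by simp
    then have "\<gamma> * x \<le> \<gamma> * T (Suc k) j 0" using assms by linarith
    then have "T (Suc k) j 0 \<le> x" using assms(1) mult_le_cancel_left_neg by blast
    then show ?thesis using F_mono[of "T (Suc k) j 0" x j] F_T[of "Suc k" j 0] \<sigma>_pos[of j]
      by (simp add: u_def)
  qed
  moreover have "(\<lambda>k. exp (- u / Suc k)) \<longlonglongrightarrow> 1"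
    by real_asymp
  ultimately have "F j x \<ge> 1" by (meson LIMSEQ_le_const2)
  then show ?thesis using N.prob_le_1 by (simp add: F_measure antisym)
qed

lemma F_interior_iff: "\<sigma> $ j + \<gamma> * x > 0 \<longleftrightarrow> 0 < F j x \<and> F j x < 1"
proof (cases "\<sigma> $ j + \<gamma> * x > 0")
  case False
  then have "\<gamma> > 0 \<or> \<gamma> < 0" using \<sigma>_pos[of j] by (cases "\<gamma> = 0") auto
  then show ?thesis using False F_below[of j x] F_above[of j x] by auto
qed (use F_interior in auto)

lemma F_pos_iff: "F j x > 0 \<longleftrightarrow> (\<gamma> > 0 \<longrightarrow> \<sigma> $ j + \<gamma> * x > 0)"
proof (cases "\<sigma> $ j + \<gamma> * x > 0")
  case False
  then have "\<gamma> > 0 \<or> \<gamma> < 0" using \<sigma>_pos[of j] by (cases "\<gamma> = 0") auto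
  then show ?thesis using False F_below[of j x] F_above[of j x] by auto
qed (use F_interior in auto)

lemma lower_endpoint_less_iff:
  "lower_endpoint (margin N j) < ereal x \<longleftrightarrow> (\<gamma> > 0 \<longrightarrow> \<sigma> $ j + \<gamma> * x > 0)"
proof -
  have "lower_endpoint (margin N j) < ereal x \<longleftrightarrow> (\<exists>y<x. F j y > 0)"
    by (auto simp: lower_endpoint_def INF_less_iff)
  also have "\<dots> \<longleftrightarrow> (\<gamma> > 0 \<longrightarrow> \<sigma> $ j + \<gamma> * x > 0)"
  proof (cases "\<gamma> > 0")
    case True
    then have "F j y > 0 \<longleftrightarrow> - \<sigma> $ j / \<gamma> < y" for y
      by (simp add: F_pos_iff field_simps) linarith
    moreover have "\<sigma> $ j + \<gamma> * x > 0 \<longleftrightarrow> - \<sigma> $ j / \<gamma> < x"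
      using True by (simp add: field_simps) linarith
    moreover have "(\<exists>y<x. c < y) \<longleftrightarrow> c < x" for c :: real
      using dense[of c x] by auto
    ultimately show ?thesis using True by simp
  qed (auto simp: F_pos_iff intro: lt_ex)
  finally show ?thesis .
qed

lemma lower_endpoint_eq:
  "lower_endpoint (margin N j) = (if \<gamma> > 0 then ereal (- \<sigma> $ j / \<gamma>) else - \<infinity>)"
proof (cases "\<gamma> > 0")
  case True
  have iff: "lower_endpoint (margin N j) < ereal x \<longleftrightarrow> ereal (- \<sigma> $ j / \<gamma>) < ereal x" for x
    using True by (simp add: lower_endpoint_less_iff field_simps) linarith
  have le: "a \<le> b" if "\<And>x. b < ereal x \<Longrightarrow> a < ereal x" for a b :: ereal
  proof (rule ccontr)
    assume "\<not> a \<le> b"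
    then obtain x where "b < ereal x" "ereal x < a" using ereal_dense2[of b a] by (auto simp: not_le)
    then show False using that[of x] by simp
  qed
  have "lower_endpoint (margin N j) = ereal (- \<sigma> $ j / \<gamma>)"
  proof (rule antisym)
    show "lower_endpoint (margin N j) \<le> ereal (- \<sigma> $ j / \<gamma>)" by (rule le) (simp only: iff)
    show "ereal (- \<sigma> $ j / \<gamma>) \<le> lower_endpoint (margin N j)" by (rule le) (simp only: iff)
  qed
  then show ?thesis using True by simp
next
  case False
  then have "lower_endpoint (margin N j) < ereal x" for x
    by (simp add: lower_endpoint_less_iff)
  then show ?thesis using False by (metis ereal_bot less_imp_le)
qed

text \<open>A margin is the limit of the joint cdf as all other arguments tend to \<open>\<infinity>\<close>. The general affine
  sequence covers both sides of the max-stability relation.\<close>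

lemma G_tendsto_F:
  assumes "\<And>i. p i > 0"
  shows "(\<lambda>n. G (\<chi> i. if i = j then r else p i * real n + q i)) \<longlonglongrightarrow> F j r"
proof -
  let ?v = "\<lambda>n. \<chi> i. if i = j then r else p i * real n + q i"
  have "(\<lambda>n. measure N {..?v n}) \<longlonglongrightarrow> measure N (\<Union>n. {..?v n})"
  proof (rule N.finite_Lim_measure_incseq)
    have "?v m \<le> ?v n" if "m \<le> n" for m n
      using that assms by (auto simp: less_eq_vec_def intro!: mult_left_mono less_imp_le)
    then show "incseq (\<lambda>n. {..?v n})" by (simp add: incseq_def)
  qed auto
  moreover have "(\<Union>n. {..?v n}) = {y. y $ j \<le> r}"
  proof safe
    fix y :: "real ^ 'n" and n assume "y \<le> ?v n"
    then have "y $ j \<le> ?v n $ j" by (simp only: less_eq_vec_def)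
    then show "y $ j \<le> r" by simp
  next
    fix y :: "real ^ 'n" assume y: "y $ j \<le> r"
    have "\<forall>\<^sub>F n in sequentially. y $ i \<le> p i * real n + q i" for i
      using assms[of i] by real_asymp
    then have "\<forall>\<^sub>F n in sequentially. \<forall>i. y $ i \<le> p i * real n + q i"
      by (rule eventually_all_finite)
    then obtain n where "\<forall>i. y $ i \<le> p i * real n + q i"
      by (auto simp: eventually_sequentially)
    then have "y \<le> ?v n" using y by (simp add: less_eq_vec_def)
    then show "y \<in> (\<Union>n. {..?v n})" by blast
  qed
  ultimately show ?thesis by (simp add: mv_cdf_def F_measure)
qed

lemma F_max_stable:
  assumes "t > 0" "\<And>i. a $ i > 0" "\<And>x. G (\<chi> i. a $ i * x $ i + b $ i) powr t = G x"
  shows "F j (a $ j * r + b $ j) powr t = F j r"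
proof -
  have "(\<lambda>n. G (\<chi> i. if i = j then a $ j * r + b $ j else a $ i * real n + b $ i) powr t)
      \<longlonglongrightarrow> F j (a $ j * r + b $ j) powr t"
    using assms(1,2) by (intro tendsto_powr' G_tendsto_F tendsto_const) (auto simp: mv_cdf_def)
  moreover have "G (\<chi> i. if i = j then a $ j * r + b $ j else a $ i * real n + b $ i) powr t
      = G (\<chi> i. if i = j then r else real n)" for n
  proof -
    have "(\<chi> i. a $ i * (\<chi> i. if i = j then r else real n) $ i + b $ i)
        = (\<chi> i. if i = j then a $ j * r + b $ j else a $ i * real n + b $ i)"
      by (auto simp: vec_eq_iff)
    then show ?thesis using assms(3)[of "\<chi> i. if i = j then r else real n"] by simp
  qed
  moreover have "(\<lambda>n. G (\<chi> i. if i = j then r else real n)) \<longlonglongrightarrow> F j r"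
    using G_tendsto_F[of "\<lambda>_. 1" j r "\<lambda>_. 0"] by (simp cong: if_cong)
  ultimately show ?thesis
    using LIMSEQ_unique by simp
qed

text \<open>The norming constants of max-stability must be those of \<open>T\<close>: by injectivity of the marginal cdfs
  the two affine maps agree wherever the marginal cdf is nontrivial, in particular at two points.\<close>

lemma G_T:
  assumes "t > 0"
  shows "G (\<chi> j. T t j (x $ j)) powr t = G x"
proof -
  have "max_stable G" using gev by (simp add: mv_gev_distribution_def)
  then obtain a b where a: "\<And>i. a $ i > 0" and ab: "\<And>x. G (\<chi> i. a $ i * x $ i + b $ i) powr t = G x"
    using assms unfolding max_stable_def by blast
  have eq: "a $ j * r + b $ j = T t j r" if r: "\<sigma> $ j + \<gamma> * r > 0" for j r
  proof -
    have *: "F j (a $ j * r + b $ j) powr t = F j r" using F_max_stable[OF assms a ab] .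
    have **: "F j (T t j r) powr t = F j r" using F_T_powr[OF assms r] .
    have "F j (a $ j * r + b $ j) = (F j (a $ j * r + b $ j) powr t) powr (1/t)"
      using assms by (simp add: powr_powr F_measure)
    also have "\<dots> = (F j (T t j r) powr t) powr (1/t)" by (simp only: * **)
    also have "\<dots> = F j (T t j r)" using assms by (simp add: powr_powr F_measure)
    finally have F: "F j (a $ j * r + b $ j) = F j (T t j r)" .
    have supp: "\<sigma> $ j + \<gamma> * T t j r > 0" using r assms by (simp add: T_support_pos_iff)
    then have "\<sigma> $ j + \<gamma> * (a $ j * r + b $ j) > 0" by (simp add: F_interior_iff F)
    then show ?thesis using F_inj supp F by blast
  qed
  have "a $ j * r + b $ j = T t j r" for j r
  proof -
    \<comment> \<open>Besides \<open>0\<close>, either \<open>1\<close> or \<open>- 1\<close> is a point where the marginal cdf is nontrivial.\<close>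
    define s :: real where "s = (if \<gamma> \<ge> 0 then 1 else -1)"
    have "\<sigma> $ j + \<gamma> * s > 0" using \<sigma>_pos[of j] by (simp add: s_def)
    then have "a $ j * s + b $ j = T t j s" by (rule eq)
    moreover have 0: "a $ j * 0 + b $ j = T t j 0" using \<sigma>_pos by (intro eq) simp
    ultimately have "a $ j = t powr \<gamma>" by (auto simp: T_def s_def split: if_splits)
    then show ?thesis using 0 by (simp add: T_def)
  qed
  then show ?thesis using ab[of x] by simp
qed

lemma G_ge: "G y \<ge> 1 - (\<Sum>j\<in>UNIV. 1 - F j (y $ j))"
proof -
  have "1 - G y = measure N (\<Union>j. {z. \<not> z $ j \<le> y $ j})"
  proof -
    have "(\<Union>j. {z. \<not> z $ j \<le> y $ j}) = space N - {..y}"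
      by (auto simp: less_eq_vec_def)
    then show ?thesis using N.prob_compl[of "{..y}"] by (simp add: mv_cdf_def)
  qed
  also have "\<dots> \<le> (\<Sum>j\<in>UNIV. measure N {z. \<not> z $ j \<le> y $ j})"
    by (rule N.finite_measure_subadditive_finite) (auto simp: image_subset_iff not_le)
  also have "\<dots> = (\<Sum>j\<in>UNIV. 1 - F j (y $ j))"
  proof (rule sum.cong)
    fix j :: 'n
    have "{z. \<not> z $ j \<le> y $ j} = space N - {z. z $ j \<le> y $ j}" by auto
    then show "measure N {z. \<not> z $ j \<le> y $ j} = 1 - F j (y $ j)"
      using N.prob_compl[of "{z. z $ j \<le> y $ j}"] by (simp add: F_measure)
  qed simp
  finally show ?thesis by simp
qed

lemma F_T_tendsto_1:
  assumes "F j x > 0"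
  shows "(\<lambda>n. F j (T (Suc n) j x)) \<longlonglongrightarrow> 1"
proof (cases "\<sigma> $ j + \<gamma> * x > 0")
  case True
  define u where "u = gp_tail \<gamma> ((x - \<mu> $ j) / \<alpha> $ j)"
  have "F j (T (Suc n) j x) = exp (- u / Suc n)" for n
    using F_T[of "Suc n" j x] True by (simp add: u_def)
  moreover have "(\<lambda>n. exp (- u / Suc n)) \<longlonglongrightarrow> 1" by real_asymp
  ultimately show ?thesis by simp
next
  case False
  then have "\<gamma> < 0" using assms F_pos_iff[of j x] \<sigma>_pos[of j] by (cases "\<gamma> = 0") auto
  moreover have "\<sigma> $ j + \<gamma> * T (Suc n) j x \<le> 0" for n
    using False T_support_pos_iff[of "Suc n" j x] by simp
  ultimately show ?thesis using F_above by simp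
qed

text \<open>For a general joint distribution positivity of the margins would not suffice. Here a zero of \<open>G\<close>
  would propagate along \<open>T t\<close>, \<open>t \<rightarrow> \<infinity>\<close>, whereas \<open>G\<close> tends to \<open>1\<close> there.\<close>

lemma G_pos:
  assumes "\<And>j. F j (x $ j) > 0"
  shows "G x > 0"
proof (rule ccontr)
  assume "\<not> G x > 0"
  then have 0: "G x = 0" by (simp add: mv_cdf_def zero_less_measure_iff)
  have "G (\<chi> j. T (Suc n) j (x $ j)) = 0" for n
    using G_T[of "Suc n" x] 0 by simp
  then have "1 - (\<Sum>j\<in>UNIV. 1 - F j (T (Suc n) j (x $ j))) \<le> 0" for n
    using G_ge[of "\<chi> j. T (Suc n) j (x $ j)"] by simp
  moreover have "(\<lambda>n. 1 - (\<Sum>j\<in>UNIV. 1 - F j (T (Suc n) j (x $ j)))) \<longlonglongrightarrow> 1 - (\<Sum>j\<in>(UNIV::'n set). 1 - 1)"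
    by (intro tendsto_intros F_T_tendsto_1 assms)
  ultimately have "1 - (\<Sum>j\<in>(UNIV::'n set). 1 - 1) \<le> (0::real)"
    by (meson LIMSEQ_le_const2)
  then show False by simp
qed

lemma ln_G_T:
  assumes "t > 0"
  shows "ln (G (\<chi> j. T t j (x $ j))) = ln (G x) / t"
proof -
  have "ln (G x) = ln (G (\<chi> j. T t j (x $ j)) powr t)" using G_T[OF assms, of x] by simp
  also have "\<dots> = t * ln (G (\<chi> j. T t j (x $ j)))" by (simp add: ln_powr)
  finally show ?thesis using assms by simp
qed

end

section \<open>Threshold stability of generalized Pareto vectors\<close>

text \<open>A random vector \<open>X\<close> with the generalized Pareto law associated to \<open>N\<close>, given by its cdf at real
  arguments.\<close>

locale gp_vector = gev_common_shape N \<gamma> \<mu> \<alpha> \<sigma> + M: prob_space M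
  for N :: "(real ^ 'n) measure" and \<gamma> :: real and \<mu> \<alpha> \<sigma> :: "real ^ 'n" and M :: "'a measure" +
  fixes X :: "'a \<Rightarrow> ereal ^ 'n"
  assumes G0: "0 < mv_cdf N 0" "mv_cdf N 0 < 1"
    and X_measurable [measurable]: "\<And>j. (\<lambda>\<omega>. X \<omega> $ j) \<in> borel_measurable M"
    and X_finite: "AE \<omega> in M. \<forall>j. X \<omega> $ j < \<infinity>"
    and X_cdf: "\<And>x. measure M {\<omega>\<in>space M. \<forall>j. X \<omega> $ j \<le> ereal (x $ j)} = mv_gp_cdf N x"
begin

abbreviation \<eta> :: "'n \<Rightarrow> ereal"
  where "\<eta> j \<equiv> lower_endpoint (margin N j)"

lemma X_cdf_below:
  assumes "ereal (x $ j) < \<eta> j"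
  shows "measure M {\<omega>\<in>space M. \<forall>j. X \<omega> $ j \<le> ereal (x $ j)} = 0"
proof -
  have "\<not> (\<forall>j. \<eta> j < ereal (x $ j))" using assms by (metis less_asym)
  then show ?thesis using assms unfolding X_cdf mv_gp_cdf_def Let_def by auto
qed

lemma X_cdf_above:
  assumes "\<And>j. \<eta> j < ereal (x $ j)"
  shows "measure M {\<omega>\<in>space M. \<forall>j. X \<omega> $ j \<le> ereal (x $ j)}
    = (ln (G (\<chi> j. min (x $ j) 0)) - ln (G x)) / ln (G 0)"
proof -
  have F: "F j (x $ j) > 0" for j using assms[of j] by (simp add: lower_endpoint_less_iff F_pos_iff)
  moreover have "F j 0 > 0" for j using \<sigma>_pos[of j] by (simp add: F_pos_iff)
  ultimately have "G (\<chi> j. min (x $ j) 0) > 0" "G x > 0" by (auto intro!: G_pos simp: min_def)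
  then show ?thesis using assms by (simp add: X_cdf mv_gp_cdf_def mv_gp_cdf_interior_def ln_div)
qed

text \<open>The inverse of \<open>T t j\<close>, extended to the extended reals with \<open>-\<infinity>\<close> as a fixed point.\<close>

definition Tinv :: "real \<Rightarrow> 'n \<Rightarrow> ereal \<Rightarrow> ereal"
  where "Tinv t j y = ereal (t powr (- \<gamma>)) * y + ereal (- (t powr (- \<gamma>) * (\<sigma> $ j * gp_shift \<gamma> t)))"

lemma Tinv_finite: "t > 0 \<Longrightarrow> y < \<infinity> \<Longrightarrow> Tinv t j y < \<infinity>"
  by (cases y) (auto simp: Tinv_def)

lemma Tinv_le_iff:
  assumes "t > 0" "y < \<infinity>"
  shows "Tinv t j y \<le> ereal x \<longleftrightarrow> y \<le> ereal (T t j x)"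
proof (cases y)
  case (real r)
  have "t powr \<gamma> > 0" using assms by simp
  then show ?thesis using assms real
    by (auto simp: Tinv_def T_def powr_minus_divide field_simps)
qed (use assms in \<open>auto simp: Tinv_def\<close>)

lemma Tinv_measurable [measurable]: "Tinv t j \<in> borel_measurable borel"
  unfolding Tinv_def by measurable

lemma T_above_iff: "t > 0 \<Longrightarrow> \<eta> j < ereal (T t j x) \<longleftrightarrow> \<eta> j < ereal x"
  by (simp add: lower_endpoint_less_iff T_support_pos_iff)

lemma T_below:
  assumes "t > 0" "ereal x < \<eta> j"
  shows "ereal (T t j x) < \<eta> j"
proof -
  have "\<gamma> > 0" using assms lower_endpoint_eq[of j] by (auto split: if_splits)
  then have iff: "ereal y < \<eta> j \<longleftrightarrow> \<sigma> $ j + \<gamma> * y < 0" for y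
    by (simp add: lower_endpoint_eq field_simps) linarith
  then show ?thesis using assms T_support_neg_iff by simp
qed

text \<open>The cdfs of both sides are compared at arguments above \<open>\<eta>\<close>, where they are given by \<open>ln G\<close>: with
  \<open>H\<close> for the cdf of \<open>X\<close>, the left-hand side is \<open>H (T x) - H (T (min x 0))\<close>, and the terms \<open>ln G\<close> at
  \<open>min (T x) 0 = min (T (min x 0)) 0\<close> cancel, which uses \<open>T 0 \<ge> 0\<close>.\<close>

lemma threshold_stability:
  assumes t: "t \<ge> 1" and A: "A \<in> sets (Pi\<^sub>M UNIV (\<lambda>_. borel))"
  shows "measure M {\<omega>\<in>space M. (\<lambda>j. Tinv t j (X \<omega> $ j)) \<in> A \<and> \<not> (\<forall>j. X \<omega> $ j \<le> ereal (T t j 0))}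
    = measure M {\<omega>\<in>space M. (\<lambda>j. X \<omega> $ j) \<in> A} / t"
proof -
  let ?S = "Pi\<^sub>M UNIV (\<lambda>_. borel) :: ('n \<Rightarrow> ereal) measure"
  define B where "B = {\<omega>\<in>space M. \<not> (\<forall>j. X \<omega> $ j \<le> ereal (T t j 0))}"
  have t0: "t > 0" using t by simp
  have B [measurable]: "B \<in> sets M" unfolding B_def by measurable
  have Y1 [measurable]: "(\<lambda>\<omega> j. Tinv t j (X \<omega> $ j)) \<in> measurable M ?S"
    by (rule measurable_PiM_single') (auto intro!: measurable_compose[OF X_measurable Tinv_measurable])
  have Y2 [measurable]: "(\<lambda>\<omega> j. X \<omega> $ j) \<in> measurable M ?S"
    by (rule measurable_PiM_single') auto
  \<comment> \<open>\<open>P\<close> is the law of the rescaled vector on \<open>B\<close>, and \<open>Q\<close> is \<open>1 / t\<close> times the law of \<open>X\<close>.\<close>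
  define P where "P = distr (density M (indicator B)) ?S (\<lambda>\<omega> j. Tinv t j (X \<omega> $ j))"
  define Q where "Q = distr (scale_measure (ennreal (1 / t)) M) ?S (\<lambda>\<omega> j. X \<omega> $ j)"
  have P_eq: "measure P C = measure M {\<omega>\<in>space M. (\<lambda>j. Tinv t j (X \<omega> $ j)) \<in> C \<and> \<omega> \<in> B}"
    if "C \<in> sets ?S" for C
  proof -
    have "(\<lambda>\<omega> j. Tinv t j (X \<omega> $ j)) -` C \<inter> space M \<in> sets M"
      using that by measurable
    then show ?thesis using that B
      unfolding P_def
      by (subst measure_distr) (auto simp: measure_def emeasure_restricted intro!: arg_cong[where f="\<lambda>A. enn2real (emeasure M A)"])
  qed
  have Q_eq: "measure Q C = measure M {\<omega>\<in>space M. (\<lambda>j. X \<omega> $ j) \<in> C} / t"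
    if "C \<in> sets ?S" for C
    using that t0 unfolding Q_def
    by (subst measure_distr) (auto simp: measure_scale_measure space_scale_measure vimage_def Int_def conj_commute cong: measurable_cong_sets)
  have box: "{f. \<forall>j. f j \<le> ereal (x j)} \<in> sets ?S" for x :: "'n \<Rightarrow> real"
  proof -
    have "{f\<in>space ?S. \<forall>j. f j \<le> ereal (x j)} \<in> sets ?S" by measurable
    then show ?thesis by (simp add: space_PiM)
  qed
  have P_box: "measure P {f. \<forall>j. f j \<le> ereal (x j)}
    = measure M {\<omega>\<in>space M. \<forall>j. X \<omega> $ j \<le> ereal (T t j (x j))}
      - measure M {\<omega>\<in>space M. \<forall>j. X \<omega> $ j \<le> ereal (T t j (min (x j) 0))}" for x
  proof -
    have "measure P {f. \<forall>j. f j \<le> ereal (x j)}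
      = measure M {\<omega>\<in>space M. (\<forall>j. Tinv t j (X \<omega> $ j) \<le> ereal (x j)) \<and> \<omega> \<in> B}"
      using P_eq[OF box] by simp
    also have "\<dots> = measure M ({\<omega>\<in>space M. \<forall>j. X \<omega> $ j \<le> ereal (T t j (x j))}
        - {\<omega>\<in>space M. \<forall>j. X \<omega> $ j \<le> ereal (T t j (min (x j) 0))})"
    proof (rule M.finite_measure_eq_AE)
      have T_min: "T t j (min a b) = min (T t j a) (T t j b)" for j a b
        using T_mono[of a b t j] T_mono[of b a t j] by (auto simp: min_def)
      have le_min: "y \<le> ereal (min a b) \<longleftrightarrow> y \<le> ereal a \<and> y \<le> ereal b" for y a b
        by (cases y) auto
      show "AE \<omega> in M. \<omega> \<in> {\<omega>\<in>space M. (\<forall>j. Tinv t j (X \<omega> $ j) \<le> ereal (x j)) \<and> \<omega> \<in> B} \<longleftrightarrow>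
        \<omega> \<in> {\<omega>\<in>space M. \<forall>j. X \<omega> $ j \<le> ereal (T t j (x j))}
        - {\<omega>\<in>space M. \<forall>j. X \<omega> $ j \<le> ereal (T t j (min (x j) 0))}"
        using X_finite by eventually_elim (auto simp: Tinv_le_iff t0 B_def T_min le_min)
    qed measurable
    also have "\<dots> = measure M {\<omega>\<in>space M. \<forall>j. X \<omega> $ j \<le> ereal (T t j (x j))}
      - measure M {\<omega>\<in>space M. \<forall>j. X \<omega> $ j \<le> ereal (T t j (min (x j) 0))}"
    proof (rule M.finite_measure_Diff)
      have "T t j (min (x j) 0) \<le> T t j (x j)" for j by (simp add: T_mono)
      then show "{\<omega>\<in>space M. \<forall>j. X \<omega> $ j \<le> ereal (T t j (min (x j) 0))}
          \<subseteq> {\<omega>\<in>space M. \<forall>j. X \<omega> $ j \<le> ereal (T t j (x j))}"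
        by (auto intro: order_trans)
    qed measurable
    finally show ?thesis .
  qed
  have Q_box: "measure Q {f. \<forall>j. f j \<le> ereal (x j)}
    = measure M {\<omega>\<in>space M. \<forall>j. X \<omega> $ j \<le> ereal (x j)} / t" for x
    using Q_eq[OF box] by simp
  have "P = Q"
  proof (rule ereal_vector_measure_eqI[where \<eta>=\<eta>])
    show "finite_measure P" unfolding P_def
      by (rule finite_measure.finite_measure_distr) (use M.finite_measure_restricted in auto)
    show "finite_measure Q" unfolding Q_def
      by (rule finite_measure.finite_measure_distr)
        (auto intro!: finite_measureI simp: ennreal_mult_eq_top_iff space_scale_measure cong: measurable_cong_sets)
    show "sets P = sets ?S" "sets Q = sets ?S" by (simp_all add: P_def Q_def)
    show "AE f in P. \<forall>j. f j < \<infinity>"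
    proof -
      have "AE \<omega> in density M (indicator B). \<forall>j. Tinv t j (X \<omega> $ j) < \<infinity>"
        using X_finite
        by (subst AE_density) (auto simp: Tinv_finite t0 simp del: ereal_infty_less)
      then show ?thesis unfolding P_def by (subst AE_distr_iff) auto
    qed
    show "AE f in Q. \<forall>j. f j < \<infinity>"
    proof -
      have "AE \<omega> in scale_measure (ennreal (1 / t)) M. \<forall>j. X \<omega> $ j < \<infinity>"
        using X_finite
        by (auto simp: eventually_ae_filter null_sets_def space_scale_measure simp del: ereal_infty_less)
      then show ?thesis unfolding Q_def by (subst AE_distr_iff) (auto cong: measurable_cong_sets)
    qed
    show "\<eta> j < \<infinity>" for j by (simp add: lower_endpoint_eq)
    show "measure P {f. \<forall>j. f j \<le> ereal (x j)} = 0" if "ereal (x j) < \<eta> j" for x j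
    proof -
      have "ereal (min (x j) 0) < \<eta> j"
        using that by (rule le_less_trans[rotated]) simp
      then have "ereal (T t j (x j)) < \<eta> j" "ereal (T t j (min (x j) 0)) < \<eta> j"
        using that by (auto intro!: T_below t0)
      then show ?thesis
        using X_cdf_below[of "\<chi> j. T t j (x j)" j] X_cdf_below[of "\<chi> j. T t j (min (x j) 0)" j]
        by (simp add: P_box)
    qed
    show "measure Q {f. \<forall>j. f j \<le> ereal (x j)} = 0" if "ereal (x j) < \<eta> j" for x j
      using X_cdf_below[of "\<chi> j. x j" j] that by (simp add: Q_box)
    fix x assume x: "\<And>j. \<eta> j < ereal (x j)"
    have x0: "\<eta> j < ereal (min (x j) 0)" for j
      using x[of j] \<sigma>_pos[of j] by (simp add: lower_endpoint_less_iff min_def)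
    have T0: "T t j 0 \<ge> 0" for j
      using \<sigma>_pos[of j] gp_shift_nonneg[OF t, of \<gamma>] by (simp add: T_def)
    have "min (T t j (min (x j) 0)) 0 = min (T t j (x j)) 0" for j
      using T0[of j] T_mono[of "x j" 0 t j] T_mono[of 0 "x j" t j] by (auto simp: min_def)
    then have "measure P {f. \<forall>j. f j \<le> ereal (x j)}
      = (ln (G (\<chi> j. T t j (min (x j) 0))) - ln (G (\<chi> j. T t j (x j)))) / ln (G 0)"
      unfolding P_box
      using X_cdf_above[of "\<chi> j. T t j (x j)"] X_cdf_above[of "\<chi> j. T t j (min (x j) 0)"] x x0 t0
      by (simp add: T_above_iff diff_divide_distrib)
    also have "\<dots> = (ln (G (\<chi> j. min (x j) 0)) - ln (G (\<chi> j. x j))) / ln (G 0) / t"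
      using ln_G_T[OF t0, of "\<chi> j. min (x j) 0"] ln_G_T[OF t0, of "\<chi> j. x j"]
      by (simp add: diff_divide_distrib mult.commute)
    also have "\<dots> = measure Q {f. \<forall>j. f j \<le> ereal (x j)}"
      using X_cdf_above[of "\<chi> j. x j"] x by (simp add: Q_box)
    finally show "measure P {f. \<forall>j. f j \<le> ereal (x j)} = measure Q {f. \<forall>j. f j \<le> ereal (x j)}" .
  qed
  then show ?thesis using P_eq[OF A] Q_eq[OF A] by (simp add: B_def cong: conj_cong)
qed

end

section \<open>Weighted sums\<close>

context gp_vector
begin

lemma S_measurable [measurable]: "(\<lambda>\<omega>. weighted_sum a (X \<omega>)) \<in> borel_measurable M"
  unfolding weighted_sum_def by measurable

text \<open>The weighted sum commutes with \<open>Tinv\<close>, with \<open>\<sigma>\<close> replaced by its weighted sum; here this is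
  expressed at the level \<open>0\<close>. If a component with positive weight is \<open>-\<infinity>\<close>, both sides are false.\<close>

lemma weighted_sum_Tinv_pos_iff:
  assumes t: "t > 0" and a: "\<And>j. a $ j \<ge> 0" and y: "\<And>j. y j < \<infinity>"
  shows "(\<Sum>j\<in>UNIV. ereal (a $ j) * Tinv t j (y j)) > 0
    \<longleftrightarrow> (\<Sum>j\<in>UNIV. ereal (a $ j) * y j) > ereal ((\<Sum>j\<in>UNIV. a $ j * \<sigma> $ j) * gp_shift \<gamma> t)"
proof -
  define p where "p = t powr (- \<gamma>)"
  define q where "q = (\<Sum>j\<in>UNIV. a $ j * \<sigma> $ j) * gp_shift \<gamma> t"
  have p: "p > 0" using t by (simp add: p_def)
  have "ereal (a $ j) * Tinv t j (y j)
      = ereal p * (ereal (a $ j) * y j) + ereal (- p * (a $ j * \<sigma> $ j * gp_shift \<gamma> t))" for j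
  proof (cases "y j")
    case (real r)
    then show ?thesis by (simp add: Tinv_def p_def algebra_simps)
  next
    case MInf
    then show ?thesis using p a[of j] by (cases "a $ j = 0") (auto simp: Tinv_def p_def)
  qed (use y[of j] in auto)
  then have "(\<Sum>j\<in>UNIV. ereal (a $ j) * Tinv t j (y j))
      = (\<Sum>j\<in>UNIV. ereal p * (ereal (a $ j) * y j)) + ereal (- p * q)"
    by (simp only: sum.distrib) (simp add: q_def sum_distrib_left sum_distrib_right mult.assoc sum_negf)
  also have "(\<Sum>j\<in>UNIV. ereal p * (ereal (a $ j) * y j)) = (\<Sum>j\<in>UNIV. ereal (a $ j) * y j) * ereal p"
    using p by (subst sum_distrib_right_ereal) (auto simp: mult.commute)
  also have "z * ereal p + ereal (- p * q) > 0 \<longleftrightarrow> z > ereal q" for z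
    using p by (cases z) (auto simp: mult.commute)
  finally show ?thesis unfolding q_def .
qed

lemma weighted_sum_threshold_stability:
  assumes t: "t \<ge> 1" and a: "\<And>j. a $ j \<ge> 0"
  shows "measure M {\<omega>\<in>space M. weighted_sum a (X \<omega>) > ereal ((\<Sum>j\<in>UNIV. a $ j * \<sigma> $ j) * gp_shift \<gamma> t)}
    = measure M {\<omega>\<in>space M. weighted_sum a (X \<omega>) > 0} / t"
proof -
  let ?S = "Pi\<^sub>M UNIV (\<lambda>_. borel) :: ('n \<Rightarrow> ereal) measure"
  define A where "A = {f :: 'n \<Rightarrow> ereal. (\<Sum>j\<in>UNIV. ereal (a $ j) * f j) > 0}"
  have t0: "t > 0" using t by simp
  have "{f\<in>space ?S. (\<Sum>j\<in>UNIV. ereal (a $ j) * f j) > 0} \<in> sets ?S" by measurable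
  then have A: "A \<in> sets ?S" by (simp add: A_def space_PiM)
  have [measurable]: "(\<lambda>\<omega>. Tinv t j (X \<omega> $ j)) \<in> borel_measurable M" for j
    by (rule measurable_compose[OF X_measurable Tinv_measurable])
  have not_below: "\<not> (\<forall>j. X \<omega> $ j \<le> ereal (T t j 0))"
    if "\<forall>j. X \<omega> $ j < \<infinity>" "(\<Sum>j\<in>UNIV. ereal (a $ j) * Tinv t j (X \<omega> $ j)) > 0" for \<omega>
  proof
    assume le: "\<forall>j. X \<omega> $ j \<le> ereal (T t j 0)"
    have "ereal (a $ j) * Tinv t j (X \<omega> $ j) \<le> 0" for j
    proof -
      have "Tinv t j (X \<omega> $ j) \<le> ereal 0" using le that(1) t0 by (subst Tinv_le_iff) auto
      then show ?thesis using a[of j] by (cases "Tinv t j (X \<omega> $ j)") (auto simp: mult_nonneg_nonpos)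
    qed
    then have "(\<Sum>j\<in>UNIV. ereal (a $ j) * Tinv t j (X \<omega> $ j)) \<le> 0" by (rule sum_nonpos)
    then show False using that(2) by simp
  qed
  have "measure M {\<omega>\<in>space M. weighted_sum a (X \<omega>) > ereal ((\<Sum>j\<in>UNIV. a $ j * \<sigma> $ j) * gp_shift \<gamma> t)}
    = measure M {\<omega>\<in>space M. (\<lambda>j. Tinv t j (X \<omega> $ j)) \<in> A \<and> \<not> (\<forall>j. X \<omega> $ j \<le> ereal (T t j 0))}"
  proof (rule M.finite_measure_eq_AE)
    show "AE \<omega> in M. \<omega> \<in> {\<omega>\<in>space M. weighted_sum a (X \<omega>) > ereal ((\<Sum>j\<in>UNIV. a $ j * \<sigma> $ j) * gp_shift \<gamma> t)}
      \<longleftrightarrow> \<omega> \<in> {\<omega>\<in>space M. (\<lambda>j. Tinv t j (X \<omega> $ j)) \<in> A \<and> \<not> (\<forall>j. X \<omega> $ j \<le> ereal (T t j 0))}"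
      using X_finite
    proof eventually_elim
      case (elim \<omega>)
      then show ?case
        using weighted_sum_Tinv_pos_iff[OF t0 a, of "\<lambda>j. X \<omega> $ j"] not_below[of \<omega>]
        by (auto simp: A_def weighted_sum_def)
    qed
    show "{\<omega>\<in>space M. (\<lambda>j. Tinv t j (X \<omega> $ j)) \<in> A \<and> \<not> (\<forall>j. X \<omega> $ j \<le> ereal (T t j 0))} \<in> sets M"
      unfolding A_def mem_Collect_eq by measurable
  qed measurable
  also have "\<dots> = measure M {\<omega>\<in>space M. (\<lambda>j. X \<omega> $ j) \<in> A} / t"
    by (rule threshold_stability[OF t A])
  finally show ?thesis by (simp add: A_def weighted_sum_def)
qed

lemma X_bounded_above:
  assumes "\<forall>j. X \<omega> $ j < \<infinity>"
  shows "\<forall>\<^sub>F n in sequentially. \<forall>j. X \<omega> $ j \<le> ereal (real n)"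
proof (rule eventually_all_finite)
  fix j
  obtain k where k: "X \<omega> $ j \<le> ereal (real k)"
  proof (cases "X \<omega> $ j")
    case (real r)
    then show ?thesis using that real_arch_simple[of r] by auto
  qed (use assms that in auto)
  show "\<forall>\<^sub>F n in sequentially. X \<omega> $ j \<le> ereal (real n)"
    using eventually_ge_at_top[of k] by eventually_elim (use k in \<open>auto intro: order_trans\<close>)
qed

lemma X_ge_lower_endpoint:
  assumes "\<gamma> > 0"
  shows "AE \<omega> in M. \<forall>j. X \<omega> $ j \<ge> ereal (- \<sigma> $ j / \<gamma>)"
proof -
  define x where "x j k n = (\<chi> i. if i = j then - \<sigma> $ j / \<gamma> - 1 / Suc k else real n)" for j :: 'n and k n :: nat
  have "AE \<omega> in M. \<not> (\<forall>i. X \<omega> $ i \<le> ereal (x j k n $ i))" for j k n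
  proof (rule AE_I')
    have "ereal (x j k n $ j) < \<eta> j" using assms by (simp add: x_def lower_endpoint_eq)
    then have "measure M {\<omega>\<in>space M. \<forall>i. X \<omega> $ i \<le> ereal (x j k n $ i)} = 0" by (rule X_cdf_below)
    then show "{\<omega>\<in>space M. \<forall>i. X \<omega> $ i \<le> ereal (x j k n $ i)} \<in> null_sets M"
      by (auto simp: null_sets_def M.emeasure_eq_measure)
  qed auto
  then have "AE \<omega> in M. \<forall>j k n. \<not> (\<forall>i. X \<omega> $ i \<le> ereal (x j k n $ i))"
    by (simp only: AE_all_countable) blast
  then show ?thesis using X_finite
  proof eventually_elim
    case (elim \<omega>)
    show ?case
    proof (rule allI, rule ccontr)
      fix j assume "\<not> X \<omega> $ j \<ge> ereal (- \<sigma> $ j / \<gamma>)"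
      then have lt: "X \<omega> $ j < ereal (- \<sigma> $ j / \<gamma>)" by simp
      obtain k where k: "X \<omega> $ j \<le> ereal (- \<sigma> $ j / \<gamma> - 1 / Suc k)"
      proof (cases "X \<omega> $ j")
        case (real r)
        then obtain k where "inverse (Suc k) < - \<sigma> $ j / \<gamma> - r"
          using lt reals_Archimedean[of "- \<sigma> $ j / \<gamma> - r"] by auto
        then show ?thesis using that[of k] real by (simp add: inverse_eq_divide)
      qed (use lt that in auto)
      obtain n where "\<forall>i. X \<omega> $ i \<le> ereal (real n)"
        using X_bounded_above[OF elim(2)] by (auto simp: eventually_sequentially)
      then have "\<forall>i. X \<omega> $ i \<le> ereal (x j k n $ i)" using k by (simp add: x_def)
      then show False using elim(1) by blast
    qed
  qed
qed

text \<open>For \<open>x \<ge> 0\<close> the marginal cdf of \<open>X\<close> at \<open>x\<close> is at most \<open>1 - ln (F i x) / ln (G 0)\<close>, and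
  \<open>F i x < 1\<close> because the upper endpoint is infinite for \<open>\<gamma> > 0\<close>.\<close>

lemma X_component_tail_pos:
  assumes "\<gamma> > 0" "x \<ge> 0"
  shows "measure M {\<omega>\<in>space M. X \<omega> $ i > ereal x} > 0"
proof -
  define v where "v n = (\<chi> j. if j = i then x else real n)" for n :: nat
  let ?A = "\<lambda>n. {\<omega>\<in>space M. \<forall>j. X \<omega> $ j \<le> ereal (v n $ j)}"
  have Fi: "0 < F i x" "F i x < 1"
    using assms \<sigma>_pos[of i] F_interior[of i x] by (simp_all add: add_pos_nonneg)
  have lnG0: "ln (G 0) < 0" using G0 by simp
  have le: "measure M (?A n) \<le> 1 - ln (F i x) / ln (G 0)" for n
  proof -
    have v0: "v n $ j \<ge> 0" for j using assms by (simp add: v_def)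
    have "0 < \<sigma> $ j + \<gamma> * v n $ j" for j using \<sigma>_pos[of j] assms v0[of j] by (simp add: add_pos_nonneg)
    then have pos: "F j (v n $ j) > 0" and above: "\<eta> j < ereal (v n $ j)" for j
      by (simp_all add: F_pos_iff lower_endpoint_less_iff)
    have "(\<chi> j. min (v n $ j) 0) = 0" using v0 by (simp add: vec_eq_iff min_def eq_iff)
    then have "measure M (?A n) = 1 - ln (G (v n)) / ln (G 0)"
      using X_cdf_above[of "v n"] above lnG0 by (simp add: diff_divide_distrib)
    moreover have "G (v n) \<le> F i x"
    proof -
      have "{..v n} \<subseteq> {y. y $ i \<le> x}"
      proof safe
        fix y assume "y \<le> v n"
        then have "y $ i \<le> v n $ i" by (simp only: less_eq_vec_def)
        then show "y $ i \<le> x" by (simp add: v_def)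
      qed
      then show ?thesis unfolding mv_cdf_def F_measure by (intro N.finite_measure_mono) auto
    qed
    then have "ln (G (v n)) \<le> ln (F i x)" using G_pos[OF pos] by simp
    ultimately show ?thesis using lnG0 by (simp add: divide_right_mono_neg)
  qed
  have "(\<lambda>n. measure M (?A n)) \<longlonglongrightarrow> measure M (\<Union>n. ?A n)"
  proof (rule M.finite_Lim_measure_incseq)
    show "incseq ?A"
    proof (rule incseq_SucI, safe)
      fix n \<omega> j assume "\<forall>j. X \<omega> $ j \<le> ereal (v n $ j)"
      moreover have "ereal (v n $ j) \<le> ereal (v (Suc n) $ j)" by (simp add: v_def)
      ultimately show "X \<omega> $ j \<le> ereal (v (Suc n) $ j)" using order_trans by blast
    qed
  qed auto
  then have "measure M (\<Union>n. ?A n) \<le> 1 - ln (F i x) / ln (G 0)"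
    using le by (meson LIMSEQ_le_const2)
  moreover have "ln (F i x) / ln (G 0) > 0" using Fi lnG0 by (simp add: divide_neg_neg)
  moreover have "measure M (\<Union>n. ?A n) = measure M {\<omega>\<in>space M. X \<omega> $ i \<le> ereal x}"
  proof (rule M.finite_measure_eq_AE)
    show "AE \<omega> in M. \<omega> \<in> (\<Union>n. ?A n) \<longleftrightarrow> \<omega> \<in> {\<omega>\<in>space M. X \<omega> $ i \<le> ereal x}"
      using X_finite AE_space
    proof eventually_elim
      case (elim \<omega>)
      obtain n where n: "\<forall>i. X \<omega> $ i \<le> ereal (real n)"
        using X_bounded_above[OF elim(1)] by (auto simp: eventually_sequentially)
      have "X \<omega> $ i \<le> ereal x" if "\<forall>j. X \<omega> $ j \<le> ereal (v m $ j)" for m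
        using that[rule_format, of i] by (simp add: v_def)
      moreover have "\<forall>j. X \<omega> $ j \<le> ereal (v n $ j)" if "X \<omega> $ i \<le> ereal x"
        using that n by (simp add: v_def)
      ultimately show ?case using elim(2) by blast
    qed
  qed measurable
  moreover have "measure M {\<omega>\<in>space M. X \<omega> $ i > ereal x} = 1 - measure M {\<omega>\<in>space M. X \<omega> $ i \<le> ereal x}"
    using M.prob_neg[of "\<lambda>\<omega>. X \<omega> $ i \<le> ereal x"] by (simp add: not_le)
  ultimately show ?thesis by linarith
qed

lemma weighted_sum_pos:
  assumes \<gamma>: "\<gamma> > 0" and a: "\<And>j. a $ j \<ge> 0" "a \<noteq> 0"
  shows "measure M {\<omega>\<in>space M. weighted_sum a (X \<omega>) > 0} > 0"
proof -
  obtain i where "a $ i \<noteq> 0" using a(2) by (auto simp: vec_eq_iff)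
  then have i: "a $ i > 0" using a(1)[of i] by simp
  define c where "c = (\<Sum>j\<in>UNIV. a $ j * \<sigma> $ j / \<gamma>)"
  \<comment> \<open>If the \<open>i\<close>-th component exceeds \<open>x\<close>, it outweighs the lower bounds \<open>- \<sigma> / \<gamma>\<close> of all others.\<close>
  define x where "x = c / a $ i"
  have "c \<ge> 0" unfolding c_def using a(1) \<sigma>_pos \<gamma> by (intro sum_nonneg) (simp add: less_imp_le)
  then have "x \<ge> 0" using i by (simp add: x_def)
  then have "0 < measure M {\<omega>\<in>space M. X \<omega> $ i > ereal x}" using X_component_tail_pos \<gamma> by blast
  also have "\<dots> \<le> measure M {\<omega>\<in>space M. weighted_sum a (X \<omega>) > 0}"
  proof (rule M.finite_measure_mono_AE)
    show "AE \<omega> in M. \<omega> \<in> {\<omega>\<in>space M. X \<omega> $ i > ereal x} \<longrightarrow> \<omega> \<in> {\<omega>\<in>space M. weighted_sum a (X \<omega>) > 0}"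
      using X_finite X_ge_lower_endpoint[OF \<gamma>]
    proof eventually_elim
      case (elim \<omega>)
      have "\<exists>r. X \<omega> $ j = ereal r" for j
        using elim(1)[rule_format, of j] elim(2)[rule_format, of j] by (cases "X \<omega> $ j") auto
      then obtain y where y: "\<And>j. X \<omega> $ j = ereal (y j)" by metis
      have ge: "y j \<ge> - \<sigma> $ j / \<gamma>" for j using elim(2)[rule_format, of j] y[of j] by simp
      have "(\<Sum>j\<in>UNIV. a $ j * y j) > 0" if "y i > x"
      proof -
        have "a $ i * y i > c" using that i by (simp add: x_def field_simps)
        moreover have "(\<Sum>j\<in>UNIV - {i}. a $ j * y j) \<ge> (\<Sum>j\<in>UNIV - {i}. - (a $ j * \<sigma> $ j / \<gamma>))"
        proof (rule sum_mono)
          fix j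
          show "- (a $ j * \<sigma> $ j / \<gamma>) \<le> a $ j * y j"
            using mult_left_mono[OF ge[of j] a(1)[of j]] by simp
        qed
        moreover have "c = a $ i * \<sigma> $ i / \<gamma> + (\<Sum>j\<in>UNIV - {i}. a $ j * \<sigma> $ j / \<gamma>)"
          unfolding c_def by (rule sum.remove) auto
        moreover have "(\<Sum>j\<in>UNIV. a $ j * y j) = a $ i * y i + (\<Sum>j\<in>UNIV - {i}. a $ j * y j)"
          by (rule sum.remove) auto
        moreover have "a $ i * \<sigma> $ i / \<gamma> \<ge> 0" using i \<sigma>_pos[of i] \<gamma> by simp
        ultimately show ?thesis by (simp add: sum_negf)
      qed
      then show ?case by (auto simp: weighted_sum_def y)
    qed
  qed measurable
  finally show ?thesis .
qed

text \<open>Every \<open>x \<ge> 0\<close> below the upper endpoint is a level \<open>s * gp_shift \<gamma> t\<close> with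
  \<open>t = 1 / gp_tail \<gamma> (x / s) \<ge> 1\<close>, so threshold stability of the sum gives its tail.\<close>

lemma gp_distribution_weighted_sum:
  assumes a: "\<And>j. a $ j \<ge> 0" "a \<noteq> 0"
    and pos: "measure M {\<omega>\<in>space M. weighted_sum a (X \<omega>) > 0} > 0"
  shows "gp_distribution
    (distr (uniform_measure M {\<omega>\<in>space M. weighted_sum a (X \<omega>) > 0}) borel (\<lambda>\<omega>. weighted_sum a (X \<omega>)))
    \<gamma> (\<Sum>j\<in>UNIV. a $ j * \<sigma> $ j)"
proof -
  define s where "s = (\<Sum>j\<in>UNIV. a $ j * \<sigma> $ j)"
  define S where "S = (\<lambda>\<omega>. weighted_sum a (X \<omega>))"
  define A where "A = {\<omega>\<in>space M. S \<omega> > 0}"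
  have [measurable]: "S \<in> borel_measurable M" unfolding S_def by measurable
  have A [measurable]: "A \<in> sets M" unfolding A_def by measurable
  have A_pos: "measure M A > 0" using pos by (simp add: A_def S_def)
  then have A_emeasure: "emeasure M A \<noteq> 0" "emeasure M A \<noteq> \<infinity>" by (auto simp: M.emeasure_eq_measure)
  obtain i where i: "a $ i \<noteq> 0" using a(2) by (auto simp: vec_eq_iff)
  have "s > 0" unfolding s_def
  proof (rule sum_pos2[where i=i])
    show "0 < a $ i * \<sigma> $ i" using i a(1)[of i] \<sigma>_pos[of i] by (simp add: less_le)
    show "0 \<le> a $ j * \<sigma> $ j" for j using a(1)[of j] \<sigma>_pos[of j] by simp
  qed auto
  have tail: "measure M {\<omega>\<in>space M. S \<omega> > ereal (s * gp_shift \<gamma> t)} = measure M A / t" if "t \<ge> 1" for t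
    using weighted_sum_threshold_stability[OF that a(1)] by (simp add: s_def S_def A_def)
  have exceed: "measure M {\<omega>\<in>space M. S \<omega> > ereal x} = (1 - gp_cdf \<gamma> s x) * measure M A" if "x \<ge> 0" for x
  proof (cases "s + \<gamma> * x > 0")
    case True
    define t where "t = 1 / gp_tail \<gamma> (x / s)"
    have arg: "1 + \<gamma> * (x / s) > 0" using True \<open>s > 0\<close> by (simp add: field_simps)
    have "t \<ge> 1" using gp_tail_le_one[OF arg] gp_tail_pos[OF arg] that \<open>s > 0\<close> by (simp add: t_def)
    moreover have "s * gp_shift \<gamma> t = x"
      using gp_shift_inverse_gp_tail[OF arg] \<open>s > 0\<close> by (simp add: t_def)
    ultimately show ?thesis using tail[of t] that True by (simp add: gp_cdf_def t_def)
  next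
    case False
    have "\<gamma> < 0"
    proof (rule ccontr)
      assume "\<not> \<gamma> < 0"
      then have "\<gamma> * x \<ge> 0" using that by simp
      then show False using False \<open>s > 0\<close> by simp
    qed
    \<comment> \<open>Now \<open>x\<close> is at or beyond the upper endpoint \<open>- s / \<gamma>\<close>, hence beyond all levels \<open>s * gp_shift \<gamma> t\<close>.\<close>
    have "measure M {\<omega>\<in>space M. S \<omega> > ereal x} \<le> measure M A / Suc k" for k
    proof -
      have "\<gamma> * (s * gp_shift \<gamma> (Suc k)) = s * (real (Suc k) powr \<gamma> - 1)"
        using gp_shift_eq[of "Suc k" \<gamma>] by (simp add: mult.left_commute)
      moreover have "s * real (Suc k) powr \<gamma> > 0" using \<open>s > 0\<close> by simp
      ultimately have "\<gamma> * x \<le> \<gamma> * (s * gp_shift \<gamma> (Suc k))"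
        using False unfolding right_diff_distrib by linarith
      then have "s * gp_shift \<gamma> (Suc k) \<le> x"
        using \<open>\<gamma> < 0\<close> mult_le_cancel_left_neg by blast
      then have le: "ereal (s * gp_shift \<gamma> (Suc k)) \<le> ereal x" by (simp only: ereal_less_eq)
      then have "measure M {\<omega>\<in>space M. S \<omega> > ereal x}
          \<le> measure M {\<omega>\<in>space M. S \<omega> > ereal (s * gp_shift \<gamma> (Suc k))}"
        by (intro M.finite_measure_mono Collect_mono conj_mono imp_refl impI le_less_trans[OF le]) measurable
      then show ?thesis using tail[of "Suc k"] by simp
    qed
    moreover have "(\<lambda>k. measure M A / Suc k) \<longlonglongrightarrow> 0" by real_asymp
    ultimately have "measure M {\<omega>\<in>space M. S \<omega> > ereal x} \<le> 0" by (meson LIMSEQ_le_const)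
    then show ?thesis using that False by (simp add: gp_cdf_def measure_le_0_iff)
  qed
  have "measure (distr (uniform_measure M A) borel S) {..ereal x} = gp_cdf \<gamma> s x" for x
  proof -
    have "measure (distr (uniform_measure M A) borel S) {..ereal x}
        = measure M (A \<inter> {\<omega>\<in>space M. S \<omega> \<le> ereal x}) / measure M A"
      using A_emeasure
      by (simp add: measure_distr measure_uniform_measure vimage_def Int_def conj_commute)
    also have "\<dots> = gp_cdf \<gamma> s x"
    proof (cases "x < 0")
      case True
      then have "\<not> (0 < z \<and> z \<le> ereal x)" for z :: ereal by (cases z) auto
      then have "A \<inter> {\<omega>\<in>space M. S \<omega> \<le> ereal x} = {}" by (auto simp: A_def)
      then show ?thesis using True by (simp add: gp_cdf_def)
    next
      case False
      have "A \<inter> {\<omega>\<in>space M. S \<omega> \<le> ereal x} = A - {\<omega>\<in>space M. S \<omega> > ereal x}"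
        by (auto simp: A_def)
      also have "measure M \<dots> = measure M A - measure M {\<omega>\<in>space M. S \<omega> > ereal x}"
      proof (rule M.finite_measure_Diff)
        have "0 < z" if "ereal x < z" for z using that False by (cases z) auto
        then show "{\<omega>\<in>space M. S \<omega> > ereal x} \<subseteq> A" by (auto simp: A_def)
      qed measurable
      finally show ?thesis using exceed[of x] False A_pos by (simp add: field_simps)
    qed
    finally show ?thesis .
  qed
  moreover have "prob_space (distr (uniform_measure M A) borel S)"
    using prob_space_uniform_measure[OF A_emeasure] by (intro prob_space.prob_space_distr) auto
  ultimately show ?thesis using \<open>s > 0\<close> by (simp add: gp_distribution_def s_def S_def A_def)
qed

end

lemma borel_measurable_vec_nth_topological:
  "(\<lambda>x :: 'b::topological_space ^ 'n. x $ j) \<in> borel_measurable borel"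
  by (rule borel_measurableI) (simp add: open_vimage_vec_nth)

theorem proposition2:
  fixes M :: "'a measure"
    and X :: "'a \<Rightarrow> ereal ^ 'n"
    and \<gamma> :: real
    and \<sigma> a :: "real ^ 'n"
  assumes "prob_space M"
    and "X \<in> M \<rightarrow>\<^sub>M borel"
    and "mv_gp_distribution (distr M borel X) (\<chi> j. \<gamma>) \<sigma>"
    and "\<forall>j. \<sigma> $ j > 0"
    and "\<forall>j. a $ j \<ge> 0"
    and "a \<noteq> 0"
    and "\<gamma> \<le> 0 \<longrightarrow> measure M {\<omega> \<in> space M. weighted_sum a (X \<omega>) > 0} > 0"
  shows "gp_distribution
    (distr (uniform_measure M {\<omega> \<in> space M. weighted_sum a (X \<omega>) > 0}) borel
      (\<lambda>\<omega>. weighted_sum a (X \<omega>)))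
    \<gamma> (\<Sum>j\<in>UNIV. a $ j * \<sigma> $ j)"
proof -
  obtain N \<mu> \<alpha> where N: "mv_gev_distribution N" "gev_margin_parameters N (\<chi> j. \<gamma>) \<mu> \<alpha>"
      "\<And>j. \<sigma> $ j = \<alpha> $ j - \<gamma> * \<mu> $ j" "0 < mv_cdf N 0" "mv_cdf N 0 < 1"
    and fin: "AE y in distr M borel X. \<forall>j. y $ j < \<infinity>"
    and cdf: "\<And>x. measure (distr M borel X) {..(\<chi> j. ereal (x $ j))} = mv_gp_cdf N x"
    using assms(3) by (auto simp: mv_gp_distribution_def)
  interpret prob_space M by fact
  interpret gp_vector N \<gamma> \<mu> \<alpha> \<sigma> M X
  proof (unfold_locales)
    show "(\<lambda>\<omega>. X \<omega> $ j) \<in> borel_measurable M" for j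
      by (rule measurable_compose[OF assms(2) borel_measurable_vec_nth_topological])
    show "AE \<omega> in M. \<forall>j. X \<omega> $ j < \<infinity>"
      by (rule AE_distrD[OF assms(2) fin])
    show "measure M {\<omega>\<in>space M. \<forall>j. X \<omega> $ j \<le> ereal (x $ j)} = mv_gp_cdf N x" for x
    proof -
      have eq: "{..(\<chi> j. ereal (x $ j))} = (\<Inter>j. (\<lambda>y. y $ j) -` {..ereal (x $ j)})"
        by (auto simp: less_eq_vec_def)
      have "closed {..(\<chi> j. ereal (x $ j))}"
        unfolding eq by (intro closed_INT ballI closed_vimage_vec_nth closed_atMost)
      then have "measure (distr M borel X) {..(\<chi> j. ereal (x $ j))}
          = measure M (X -` {..(\<chi> j. ereal (x $ j))} \<inter> space M)"
        using assms(2) by (intro measure_distr borel_closed)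
      also have "X -` {..(\<chi> j. ereal (x $ j))} \<inter> space M = {\<omega>\<in>space M. \<forall>j. X \<omega> $ j \<le> ereal (x $ j)}"
        by (auto simp: less_eq_vec_def)
      finally show ?thesis using cdf by simp
    qed
  qed (use N assms(4) in auto)
  have "measure M {\<omega>\<in>space M. weighted_sum a (X \<omega>) > 0} > 0"
    using weighted_sum_pos assms(5-7) by (cases "\<gamma> > 0") auto
  then show ?thesis using gp_distribution_weighted_sum assms(5,6) by blast
qed

end
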